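(* Let $n \ge 3$ and let $C_n$ be the cycle of order $n$. The restrained dominating coalition number of $C_n$ is $$ RC(C_n)= \begin{cases} 3, & \text{if } n=3,5,\\ 4, & \text{if } n=4,8,\\ 5, & \text{if } n=7,11,\\ 6, & \text{otherwise.} \end{cases} $$
   Context: Let $G$ be a graph with vertex set $V$. A subset $D \subseteq V$ is a dominating set if every vertex of $V \setminus D$ is adjacent to a vertex of $D$. A subset $R \subseteq V$ is a restrained dominating set (RD-set) if $R$ is a dominating set and every vertex of $V \setminus R$ has at least one neighbor in $V \setminus R$ (in particular $V$ itself is an RD-set). Two disjoint subsets of $V$ form a restrained dominating coalition (RD-coalition) if neither of them is an RD-set but their union is an RD-set. A restrained dominating coalition partition (RD-partition) of $G$ is a partition $\pi$ of $V$ into nonempty sets such that every set of $\pi$ that is not an RD-set forms an RD-coalition with some other set of $\pi$, and every set of $\pi$ that is an RD-set is a single-vertex set. The restrained dominating coalition number $RC(G)$ is the maximum cardinality of an RD-partition of $G$. *)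

theory Defs
  imports "HOL-Library.Disjoint_Sets" "Graph_Theory.Pair_Digraph"
begin

text \<open>
  Simple graphs are the symmetric loop-free digraphs of \<^locale>\<open>pair_graph\<close>; \<open>u\<close> and \<open>v\<close> are
  adjacent iff \<open>(u, v) \<in> parcs G\<close>.
\<close>

definition dominating_set :: "'a pair_pre_digraph \<Rightarrow> 'a set \<Rightarrow> bool" where
  "dominating_set G D \<longleftrightarrow>
     D \<subseteq> pverts G \<and> (\<forall>v \<in> pverts G - D. \<exists>u \<in> D. (v, u) \<in> parcs G)"

definition RD_set :: "'a pair_pre_digraph \<Rightarrow> 'a set \<Rightarrow> bool" where
  "RD_set G R \<longleftrightarrow>
     dominating_set G R \<and> (\<forall>v \<in> pverts G - R. \<exists>u \<in> pverts G - R. (v, u) \<in> parcs G)"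

definition RD_coalition :: "'a pair_pre_digraph \<Rightarrow> 'a set \<Rightarrow> 'a set \<Rightarrow> bool" where
  "RD_coalition G A B \<longleftrightarrow>
     A \<subseteq> pverts G \<and> B \<subseteq> pverts G \<and> A \<inter> B = {} \<and>
     \<not> RD_set G A \<and> \<not> RD_set G B \<and> RD_set G (A \<union> B)"

definition RD_partition :: "'a pair_pre_digraph \<Rightarrow> 'a set set \<Rightarrow> bool" where
  "RD_partition G P \<longleftrightarrow>
     partition_on (pverts G) P \<and>
     (\<forall>A \<in> P. \<not> RD_set G A \<longrightarrow> (\<exists>B \<in> P - {A}. RD_coalition G A B)) \<and>
     (\<forall>A \<in> P. RD_set G A \<longrightarrow> is_singleton A)"

text \<open>
  For a finite graph the set below is finite; if the graph has no RD-partition at all, the set is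
  empty and its \<^const>\<open>Max\<close> is an unspecified number.
\<close>

definition RC :: "'a pair_pre_digraph \<Rightarrow> nat" where
  "RC G = Max {card P | P. RD_partition G P}"

definition cycle_graph :: "nat \<Rightarrow> nat pair_pre_digraph" where
  "cycle_graph n =
     \<lparr> pverts = {..<n},
       parcs = {(i, j). i < n \<and> j < n \<and> (j = (i + 1) mod n \<or> i = (j + 1) mod n)} \<rparr>"

text \<open>The formula gives a loop for \<open>n = 1\<close> and a single edge for \<open>n = 2\<close>.\<close>

lemma pair_graph_cycle_graph:
  assumes "n \<ge> 3"
  shows "pair_graph (cycle_graph n)"
proof
  show "finite (parcs (cycle_graph n))"
    by (rule finite_subset[of _ "{..<n} \<times> {..<n}"]) (auto simp: cycle_graph_def)
next
  show "symmetric (with_proj (cycle_graph n))"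
    by (auto simp: cycle_graph_def symmetric_def sym_def)
next
  fix e
  assume "e \<in> parcs (cycle_graph n)"
  then show "fst e \<noteq> snd e"
    using assms by (auto simp: cycle_graph_def mod_Suc split: if_splits)
qed (auto simp: cycle_graph_def)

end

theory Submission
  imports Defs
begin

text \<open>
  In a cycle a set \<open>R\<close> is a restrained dominating set iff every vertex outside \<open>R\<close> has exactly one
  neighbour in \<open>R\<close>: its complement is a union of separated pairs of consecutive vertices. This is a
  condition on windows of three consecutive vertices (\<open>RD_set_cycle_iff\<close>), and it yields
  \<open>n = \<bar>R\<bar> + 2 * g\<close> with \<open>g \<le> \<bar>R\<bar>\<close>, where \<open>g\<close> is the number of pairs (\<open>card_RD_set_cycle\<close>).

  Upper bounds. Join two classes of an RD-partition by an edge if their union is an RD-set. A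
  class \<open>A\<close> that is not an RD-set fails on some window, and that window gives at most three
  classes other than \<open>A\<close> which together meet every edge (\<open>ex_hitting_classes\<close>). For \<open>n \<ge> 4\<close> an
  RD-set has at least two vertices, so every class has a partner and the graph of coalitions,
  having no isolated vertex, is spanned by a forest of \<open>k\<close> stars. A hitting set avoiding the
  centre of a star contains all leaves of this star and at least one vertex of each other star, so
  a star has at most \<open>4 - k\<close> leaves, and there are at most \<open>k * (5 - k) \<le> 6\<close> classes. If all
  RD-sets have at least \<open>m\<close> vertices, a star with \<open>d\<close> leaves covers at least \<open>m + d - 1\<close> vertices,
  since centre and one leaf cover \<open>m\<close> and the other leaves are nonempty; this gives
  \<open>k * (m - 2) + \<bar>P\<bar> \<le> n\<close> (\<open>RD_partition_cycle_bounds\<close>). Parity makes \<open>m\<close> large for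
  \<open>n = 5, 7, 8, 11\<close>, namely \<open>m = 3, 3, 4, 5\<close>, and the second inequality then lowers the bound \<open>6\<close>.
  Only for \<open>n = 5\<close> one case survives, a single star with three leaves, and it would force a
  triangle in the cycle.

  Lower bounds. A partition is written as a cyclic word, whose letters name the classes. Whether sets of
  letters are RD-sets depends only on the windows of the word, and repeating a block of three
  letters more often adds no window once it occurs twice. Hence three words with a repeatable
  block give six classes for all \<open>n\<close> in the three residue classes modulo \<open>3\<close>, from \<open>6\<close>, \<open>10\<close> and
  \<open>14\<close> on, and the remaining orders are covered by one explicit partition each.
\<close>

section \<open>Star forests and hitting sets\<close>

text \<open>
  \<open>C\<close> is the set of centres and \<open>g\<close> sends a leaf to its centre. Every edge of an inclusion-minimal
  edge cover has an endpoint that lies in no other edge of the cover; these endpoints are the leaves.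
\<close>

lemma ex_spanning_star_forest:
  assumes "finite E" and edges: "\<And>e. e \<in> E \<Longrightarrow> card e = 2"
  obtains C g where "C \<subseteq> \<Union>E" and "g ` (\<Union>E - C) = C"
    and "\<And>v. v \<in> \<Union>E - C \<Longrightarrow> {v, g v} \<in> E"
proof -
  define Q where "Q F \<longleftrightarrow> F \<subseteq> E \<and> \<Union>F = \<Union>E" for F
  obtain F where F: "Q F" and min: "\<And>F'. Q F' \<Longrightarrow> F' \<subseteq> F \<Longrightarrow> F' = F"
  proof -
    have "finite {F. Q F}"
      by (rule finite_subset[of _ "Pow E"]) (auto simp: Q_def \<open>finite E\<close>)
    moreover have "E \<in> {F. Q F}" by (simp add: Q_def)
    ultimately obtain F where "F \<in> {F. Q F}" "\<forall>F'\<in>{F. Q F}. F' \<le> F \<longrightarrow> F = F'"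
      using finite_has_minimal2[of "{F. Q F}" E] by metis
    then show ?thesis using that by blast
  qed
  have "\<exists>x. x \<in> e \<and> (\<forall>e'\<in>F - {e}. x \<notin> e')" if "e \<in> F" for e
  proof (rule ccontr)
    assume "\<not> ?thesis"
    then have "\<Union>(F - {e}) = \<Union>F" using that by blast
    then have "Q (F - {e})" using F by (auto simp: Q_def)
    then have "F - {e} = F" using min by blast
    then show False using that by blast
  qed
  then obtain l where l: "\<And>e. e \<in> F \<Longrightarrow> l e \<in> e"
    and priv: "\<And>e e'. e \<in> F \<Longrightarrow> e' \<in> F \<Longrightarrow> l e \<in> e' \<Longrightarrow> e' = e"
    by (metis Diff_iff singletonD)
  have "\<exists>u. u \<noteq> l e \<and> e = {l e, u}" if "e \<in> F" for e
  proof -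
    have "e \<in> E" using that F unfolding Q_def by blast
    then obtain x y where "e = {x, y}" "x \<noteq> y" using edges unfolding card_2_iff by blast
    then show ?thesis using l[OF that] by auto
  qed
  then obtain c where c: "\<And>e. e \<in> F \<Longrightarrow> c e \<noteq> l e \<and> e = {l e, c e}" by metis
  define C where "C = \<Union>E - l ` F"
  define g where "g v = c (THE e. e \<in> F \<and> l e = v)" for v
  have g: "g (l e) = c e" if "e \<in> F" for e
  proof -
    have "(THE e'. e' \<in> F \<and> l e' = l e) = e"
      using that priv l by (intro the_equality) metis+
    then show ?thesis by (simp add: g_def)
  qed
  have leaves: "\<Union>E - C = l ` F"
    using F l by (auto simp: C_def Q_def)
  have cC: "c e \<in> C" if "e \<in> F" for e
  proof -
    have "c e \<in> \<Union>E" using c[OF that] that F unfolding Q_def by blast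
    moreover have "c e \<noteq> l e'" if "e' \<in> F" for e'
      using priv[of e' e] c[of e] that \<open>e \<in> F\<close> by (metis insertCI)
    ultimately show ?thesis by (auto simp: C_def)
  qed
  show thesis
  proof (rule that)
    show "C \<subseteq> \<Union>E" by (simp add: C_def)
    show "g ` (\<Union>E - C) = C"
    proof
      show "g ` (\<Union>E - C) \<subseteq> C" using g cC leaves by auto
      show "C \<subseteq> g ` (\<Union>E - C)"
      proof
        fix x assume "x \<in> C"
        then have "x \<in> \<Union>F" using F by (simp add: C_def Q_def)
        then obtain e where e: "e \<in> F" "x \<in> e" by blast
        have "x \<noteq> l e" using \<open>x \<in> C\<close> e(1) by (auto simp: C_def)
        then have "x = c e" using e c[of e] by blast
        then have "x = g (l e)" using g e by simp
        then show "x \<in> g ` (\<Union>E - C)" using leaves e by blast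
      qed
    qed
    show "{v, g v} \<in> E" if "v \<in> \<Union>E - C" for v
    proof -
      obtain e where e: "e \<in> F" "v = l e" using \<open>v \<in> \<Union>E - C\<close> leaves by auto
      then have "{v, g v} = e" using c[of e] g by metis
      then show ?thesis using F e(1) by (auto simp: Q_def)
    qed
  qed
qed

text \<open>
  Here \<open>k\<close> is the number of stars of a spanning star forest. A hitting set avoiding a centre \<open>c\<close>
  contains all leaves at \<open>c\<close> and at least one vertex of each of the \<open>k - 1\<close> other stars, so there are at
  most \<open>d + 1 - k\<close> leaves at \<open>c\<close>; a star with \<open>l\<close> leaves has weight at least \<open>m + l - 1\<close>, by counting
  one edge and then \<open>1\<close> for each further leaf.
\<close>

lemma edge_cover_bounds:
  fixes w :: "'a \<Rightarrow> nat"
  assumes "finite V" "V \<noteq> {}" and cover: "\<Union>E = V" and edges: "\<And>e. e \<in> E \<Longrightarrow> card e = 2"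
    and hit: "\<And>v. v \<in> V \<Longrightarrow> \<exists>T\<subseteq>V. v \<notin> T \<and> card T \<le> d \<and> (\<forall>e\<in>E. e \<inter> T \<noteq> {})"
    and pos: "\<And>v. v \<in> V \<Longrightarrow> 1 \<le> w v"
    and heavy: "\<And>e. e \<in> E \<Longrightarrow> m \<le> sum w e" and "2 \<le> m"
  obtains k where "1 \<le> k" and "card V \<le> k * (d + 2 - k)" and "k * (m - 2) + card V \<le> sum w V"
proof -
  have "finite E" using assms(1) cover by (metis finite_UnionD)
  then obtain C g where C: "C \<subseteq> V" "g ` (V - C) = C" and gE: "\<And>v. v \<in> V - C \<Longrightarrow> {v, g v} \<in> E"
    using ex_spanning_star_forest[OF _ edges] cover by metis
  have fin: "finite C" "finite (V - C)" using C assms(1) finite_subset by auto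
  define D where "D c = {v \<in> V - C. g v = c}" for c
  have Dfin: "finite (D c)" for c using fin by (simp add: D_def)
  have Dne: "D c \<noteq> {}" if "c \<in> C" for c
  proof -
    obtain v where "v \<in> V - C" "g v = c" using \<open>c \<in> C\<close> C(2) by (metis imageE)
    then show ?thesis by (auto simp: D_def)
  qed
  have split: "sum f V = (\<Sum>c\<in>C. f c + sum f (D c))" for f :: "'a \<Rightarrow> nat"
  proof -
    have "sum f V = sum f C + sum f (V - C)"
      using sum.subset_diff[OF C(1) assms(1), of f] by simp
    also have "sum f (V - C) = (\<Sum>c\<in>C. sum f (D c))"
      unfolding D_def using sum.group[of "V - C" C g f] fin C(2) by simp
    finally show ?thesis by (simp add: sum.distrib)
  qed
  have cardV: "card V = (\<Sum>c\<in>C. 1 + card (D c))" using split[of "\<lambda>_. 1"] by simp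
  have deg: "card (D c) + card C \<le> d + 1" if "c \<in> C" for c
  proof -
    obtain T where T: "T \<subseteq> V" "c \<notin> T" "card T \<le> d" and hitT: "\<And>e. e \<in> E \<Longrightarrow> e \<inter> T \<noteq> {}"
      using hit[OF subsetD[OF C(1) \<open>c \<in> C\<close>]] by blast
    have leaf: "v \<in> T" if "v \<in> D x" "x \<notin> T" for v x
      using that hitT[OF gE, of v] by (auto simp: D_def)
    have "finite T" using T(1) assms(1) finite_subset by blast
    have DT: "D c \<subseteq> T" using leaf T(2) by blast
    \<comment> \<open>r maps a vertex to the centre of its star; it shows that the part of T outside the star of c
        meets all the other stars.\<close>
    define r where "r v = (if v \<in> C then v else g v)" for v
    have "C - {c} \<subseteq> r ` (T - D c)"
    proof
      fix x assume x: "x \<in> C - {c}"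
      show "x \<in> r ` (T - D c)"
      proof (cases "x \<in> T")
        case True
        then show ?thesis using x by (intro image_eqI[of _ _ x]) (auto simp: r_def D_def)
      next
        case False
        obtain v where "v \<in> D x" using Dne x by blast
        then show ?thesis using leaf[OF _ False] x
          by (intro image_eqI[of _ _ v]) (auto simp: r_def D_def)
      qed
    qed
    then have "card (C - {c}) \<le> card (T - D c)"
      using \<open>finite T\<close> by (meson card_image_le card_mono finite_Diff finite_imageI le_trans)
    also have "\<dots> = card T - card (D c)" using DT Dfin by (simp add: card_Diff_subset)
    finally have "card C - 1 \<le> card T - card (D c)" using that by simp
    moreover have "card (D c) \<le> card T" using DT \<open>finite T\<close> by (rule card_mono[rotated])
    moreover have "1 \<le> card C" using that fin by (metis card_gt_0_iff One_nat_def Suc_leI empty_iff)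
    ultimately show ?thesis using T(3) by linarith
  qed
  have "C \<noteq> {}" using C assms(2) by auto
  show thesis
  proof
    show "1 \<le> card C" using \<open>C \<noteq> {}\<close> fin by (simp add: Suc_leI card_gt_0_iff)
    have "1 + card (D c) \<le> d + 2 - card C" if "c \<in> C" for c using deg[OF that] by simp
    then show "card V \<le> card C * (d + 2 - card C)"
      unfolding cardV using sum_bounded_above[of C "\<lambda>c. 1 + card (D c)" "d + 2 - card C"] by simp
    have "(m - 2) + (1 + card (D c)) \<le> w c + sum w (D c)" if c: "c \<in> C" for c
    proof -
      obtain v where v: "v \<in> D c" using Dne[OF c] by blast
      have "{v, c} \<in> E" "v \<noteq> c" using v gE[of v] c by (auto simp: D_def)
      then have "m \<le> w v + w c" using heavy[of "{v, c}"] by simp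
      moreover have "sum w (D c) = w v + sum w (D c - {v})" using sum.remove[OF Dfin v] by simp
      moreover have "card (D c - {v}) \<le> sum w (D c - {v})"
        using sum_mono[of "D c - {v}" "\<lambda>_. 1" w] pos by (simp add: D_def)
      moreover have "card (D c) = Suc (card (D c - {v}))" using card.remove[OF Dfin v] .
      ultimately show ?thesis using \<open>2 \<le> m\<close> by simp
    qed
    then have "(\<Sum>c\<in>C. (m - 2) + (1 + card (D c))) \<le> (\<Sum>c\<in>C. w c + sum w (D c))"
      by (rule sum_mono)
    then show "card C * (m - 2) + card V \<le> sum w V"
      unfolding split[of w] cardV by (simp only: sum.distrib sum_constant) simp
  qed
qed

section \<open>Restrained dominating sets of a cycle\<close>

lemma cycle_adjacent_iff:
  assumes "3 \<le> n" "i < n"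
  shows "((i + 1) mod n, u) \<in> parcs (cycle_graph n) \<longleftrightarrow> u = i \<or> u = (i + 2) mod n"
  using assms by (auto simp: cycle_graph_def mod_Suc split: if_splits)

text \<open>
  The windows are indexed by their first vertex, so that the vertex tested is the middle one. Being
  dominated and having a neighbour in the complement say together that exactly one of its two
  neighbours lies in \<open>R\<close>.
\<close>

lemma RD_set_cycle_iff:
  assumes "3 \<le> n"
  shows "RD_set (cycle_graph n) R \<longleftrightarrow>
    R \<subseteq> {..<n} \<and> (\<forall>i<n. (i + 1) mod n \<notin> R \<longrightarrow> (i \<in> R) \<noteq> ((i + 2) mod n \<in> R))"
proof -
  define s where "s i = (i + 1) mod n" for i
  define t where "t i = (i + 2) mod n" for i
  have verts: "pverts (cycle_graph n) = {..<n}" by (simp add: cycle_graph_def)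
  have adj: "(s i, u) \<in> parcs (cycle_graph n) \<longleftrightarrow> u = i \<or> u = t i" if "i < n" for i u
    using cycle_adjacent_iff[OF assms that] by (simp add: s_def t_def)
  have bounds: "s i < n" "t i < n" for i using assms by (auto simp: s_def t_def)
  have surj: "\<exists>i<n. v = s i" if "v < n" for v
    unfolding s_def using that assms by (intro exI[of _ "if v = 0 then n - 1 else v - 1"]) auto
  have "(\<exists>u\<in>R. (s i, u) \<in> parcs (cycle_graph n)) \<longleftrightarrow> i \<in> R \<or> t i \<in> R" if "i < n" for i
    by (auto simp: adj[OF that])
  moreover have "(\<exists>u\<in>{..<n} - R. (s i, u) \<in> parcs (cycle_graph n)) \<longleftrightarrow> i \<notin> R \<or> t i \<notin> R"
    if "i < n" for i
    using bounds(2) that by (auto simp: adj[OF that])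
  moreover have "(\<forall>v\<in>{..<n} - R. Q v) \<longleftrightarrow> (\<forall>i<n. s i \<notin> R \<longrightarrow> Q (s i))" for Q
    using surj bounds(1) by fastforce
  ultimately have "RD_set (cycle_graph n) R \<longleftrightarrow>
      R \<subseteq> {..<n} \<and> (\<forall>i<n. s i \<notin> R \<longrightarrow> (i \<in> R) \<noteq> (t i \<in> R))"
    unfolding RD_set_def dominating_set_def verts by auto
  then show ?thesis by (simp only: s_def t_def)
qed

text \<open>
  The complement of \<open>R\<close> falls into \<open>g\<close> pairs of consecutive vertices, and the vertex after each pair
  lies in \<open>R\<close>. In the proof \<open>M1\<close> collects the first and \<open>M2\<close> the second vertices of the pairs.
\<close>

lemma card_RD_set_cycle:
  assumes n: "3 \<le> n" and R: "RD_set (cycle_graph n) R"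
  obtains g where "g \<le> card R" and "n = card R + 2 * g"
proof -
  define s where "s i = (i + 1) mod n" for i
  have inj: "inj_on s {..<n}"
    by (auto simp: inj_on_def s_def mod_Suc split: if_splits)
  have sn: "s i < n" for i using n by (simp add: s_def)
  have surj: "s ` {..<n} = {..<n}"
    by (rule endo_inj_surj) (use inj sn in auto)
  have ss: "s (s i) = (i + 2) mod n" for i using n by (simp add: s_def mod_simps)
  have RD: "R \<subseteq> {..<n}" "\<And>i. i < n \<Longrightarrow> s i \<notin> R \<Longrightarrow> (i \<in> R) \<noteq> (s (s i) \<in> R)"
    using R unfolding RD_set_cycle_iff[OF n] ss unfolding s_def by blast+
  define M where "M = {..<n} - R"
  define M1 where "M1 = {v \<in> M. s v \<in> M}"
  define M2 where "M2 = {v \<in> M. s v \<in> R}"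
  have fin: "finite M" "finite R" "finite M1" "finite M2"
    using RD(1) finite_subset by (auto simp: M_def M1_def M2_def)
  have "s ` M1 = M2"
  proof
    show "s ` M1 \<subseteq> M2" using RD(2) sn by (auto simp: M1_def M2_def M_def)
    show "M2 \<subseteq> s ` M1"
    proof
      fix x assume x: "x \<in> M2"
      then obtain i where i: "i < n" "x = s i" using surj by (auto simp: M2_def M_def)
      then show "x \<in> s ` M1" using RD(2)[of i] x by (auto simp: M1_def M2_def M_def)
    qed
  qed
  then have "card M2 = card M1"
    using inj card_image[of s M1] by (auto simp: inj_on_def M1_def M_def)
  moreover have "card M = card M1 + card M2"
  proof -
    have "M = M1 \<union> M2" using sn by (auto simp: M1_def M2_def M_def)
    moreover have "M1 \<inter> M2 = {}" by (auto simp: M1_def M2_def M_def)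
    ultimately show ?thesis using fin by (simp add: card_Un_disjoint)
  qed
  moreover have "card M2 \<le> card R"
    by (rule card_inj_on_le[of s]) (use inj fin in \<open>auto simp: inj_on_def M2_def M_def\<close>)
  moreover have "n = card R + card M"
    using RD(1) card_mono[OF _ RD(1)] by (simp add: M_def card_Diff_subset fin)
  ultimately show thesis using that[of "card M2"] by simp
qed

section \<open>Upper bounds\<close>

text \<open>
  Take a window \<open>i, j, l\<close> on which \<open>A\<close> fails: \<open>j \<notin> A\<close>, and \<open>i\<close>, \<open>l\<close> are both outside or both in \<open>A\<close>. If
  both are outside, every RD-set meets the window, so the classes of its vertices hit every coalition.
  If both are in \<open>A\<close>, a union of two classes contains both or neither of \<open>i\<close>, \<open>l\<close>, so it must contain \<open>j\<close>
  to be an RD-set, and the class of \<open>j\<close> alone is a hitting set.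
\<close>

lemma ex_hitting_classes:
  assumes n: "3 \<le> n" and P: "partition_on {..<n} P" and A: "A \<in> P" "\<not> RD_set (cycle_graph n) A"
  shows "\<exists>T\<subseteq>P. A \<notin> T \<and> card T \<le> 3 \<and>
    (\<forall>X\<in>P. \<forall>Y\<in>P. RD_set (cycle_graph n) (X \<union> Y) \<longrightarrow> X \<in> T \<or> Y \<in> T)"
proof -
  have "A \<subseteq> {..<n}" using A(1) P by (auto simp: partition_on_def)
  then obtain i where i: "i < n" "(i + 1) mod n \<notin> A" "i \<in> A \<longleftrightarrow> (i + 2) mod n \<in> A"
    using A(2) unfolding RD_set_cycle_iff[OF n] by blast
  define j where "j = (i + 1) mod n"
  define l where "l = (i + 2) mod n"
  have bounds: "i < n" "j < n" "l < n" using i n by (auto simp: j_def l_def)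
  have "\<exists>X\<in>P. v \<in> X" if "v < n" for v using that P by (auto simp: partition_on_def)
  then obtain q where q: "\<And>v. v < n \<Longrightarrow> q v \<in> P \<and> v \<in> q v" by metis
  have uniq: "X = q v" if "X \<in> P" "v \<in> X" "v < n" for X v
    using that q[of v] P unfolding partition_on_def disjoint_def by blast
  have RD: "j \<in> R \<or> (i \<in> R) \<noteq> (l \<in> R)" if "RD_set (cycle_graph n) R" for R
    using that i(1) unfolding RD_set_cycle_iff[OF n] j_def l_def by blast
  show ?thesis
  proof (cases "i \<in> A")
    case False
    have "card {q i, q j, q l} \<le> 3" by (simp add: card_insert_if)
    moreover have "A \<notin> {q i, q j, q l}" using q bounds i False unfolding j_def l_def by blast
    moreover have "X \<in> {q i, q j, q l} \<or> Y \<in> {q i, q j, q l}"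
      if "X \<in> P" "Y \<in> P" "RD_set (cycle_graph n) (X \<union> Y)" for X Y
      using RD[OF that(3)] uniq[OF that(1)] uniq[OF that(2)] bounds by blast
    ultimately show ?thesis using q bounds by (intro exI[of _ "{q i, q j, q l}"]) auto
  next
    case True
    have "X = q j \<or> Y = q j"
      if "X \<in> P" "Y \<in> P" "RD_set (cycle_graph n) (X \<union> Y)" for X Y
    proof -
      have "A = q i" "A = q l" using uniq A(1) True i bounds unfolding l_def by auto
      then have "i \<in> X \<longleftrightarrow> l \<in> X" "i \<in> Y \<longleftrightarrow> l \<in> Y"
        using that(1,2) uniq bounds by (metis q)+
      then show ?thesis using RD[OF that(3)] uniq that(1,2) bounds by blast
    qed
    then show ?thesis using q bounds i by (intro exI[of _ "{q j}"]) (auto simp: j_def)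
  qed
qed

lemma sum_card_partition_on:
  assumes "partition_on V P" "finite V"
  shows "sum card P = card V"
proof -
  have "finite A" if "A \<in> P" for A
    using that assms by (metis Union_upper finite_subset partition_onD1)
  then show ?thesis
    using card_Union_disjoint[of P] partition_onD1[OF assms(1)] partition_onD2[OF assms(1)]
    by simp
qed

lemma card_pos_partition_on:
  assumes "finite V" "partition_on V P" "A \<in> P"
  shows "1 \<le> card A"
proof -
  have "finite A" "A \<noteq> {}"
    using assms partition_onD3 by (metis Union_upper finite_subset partition_onD1)+
  then show ?thesis by (simp add: Suc_leI card_gt_0_iff)
qed

lemma card_partition_on_le:
  assumes "finite V" "partition_on V P"
  shows "card P \<le> card V"
proof -
  have "(\<Sum>A\<in>P. 1) \<le> sum card P"
    by (rule sum_mono) (rule card_pos_partition_on[OF assms])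
  then show ?thesis using sum_card_partition_on[OF assms(2,1)] by simp
qed

text \<open>
  The star forest bounds for the graph of coalitions, with the sizes of the classes as weights. Since
  \<open>m \<ge> 2\<close>, no single-vertex class is an RD-set, so every class has a partner.
\<close>

lemma RD_partition_cycle_bounds:
  assumes n: "4 \<le> n" and P: "RD_partition (cycle_graph n) P"
    and m: "2 \<le> m" "\<And>R. RD_set (cycle_graph n) R \<Longrightarrow> m \<le> card R"
  obtains k where "1 \<le> k" and "card P \<le> k * (5 - k)" and "k * (m - 2) + card P \<le> n"
proof -
  have n3: "3 \<le> n" using n by simp
  have verts: "pverts (cycle_graph n) = {..<n}" by (simp add: cycle_graph_def)
  have part: "partition_on {..<n} P" using P by (simp add: RD_partition_def verts)
  have finP: "finite P" using part finite_elements by blast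
  have notRD: "\<not> RD_set (cycle_graph n) A" if "A \<in> P" for A
  proof
    assume RD: "RD_set (cycle_graph n) A"
    then have "card A = 1" using P that by (auto simp: RD_partition_def is_singleton_altdef)
    then show False using m(1) m(2)[OF RD] by simp
  qed
  define E where "E = {{A, B} | A B. A \<in> P \<and> B \<in> P \<and> A \<noteq> B \<and> RD_set (cycle_graph n) (A \<union> B)}"
  have cover: "\<Union>E = P"
  proof
    show "P \<subseteq> \<Union>E"
    proof
      fix A assume A: "A \<in> P"
      then obtain B where "B \<in> P - {A}" "RD_coalition (cycle_graph n) A B"
        using P notRD[OF A] unfolding RD_partition_def by blast
      then have "{A, B} \<in> E" using A unfolding E_def RD_coalition_def by blast
      then show "A \<in> \<Union>E" by blast
    qed
  qed (auto simp: E_def)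
  have edges: "card e = 2" if "e \<in> E" for e
    using that unfolding E_def card_2_iff by blast
  have hit: "\<exists>T\<subseteq>P. A \<notin> T \<and> card T \<le> 3 \<and> (\<forall>e\<in>E. e \<inter> T \<noteq> {})" if "A \<in> P" for A
  proof -
    obtain T where T: "T \<subseteq> P" "A \<notin> T" "card T \<le> 3"
      and hit: "\<And>X Y. X \<in> P \<Longrightarrow> Y \<in> P \<Longrightarrow> RD_set (cycle_graph n) (X \<union> Y) \<Longrightarrow> X \<in> T \<or> Y \<in> T"
      using ex_hitting_classes[OF n3 part \<open>A \<in> P\<close> notRD[OF \<open>A \<in> P\<close>]] by metis
    have "e \<inter> T \<noteq> {}" if "e \<in> E" for e
      using that hit unfolding E_def by blast
    then show ?thesis using T by blast
  qed
  have pos: "1 \<le> card A" if "A \<in> P" for A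
    using card_pos_partition_on[OF _ part that] by simp
  have heavy: "m \<le> sum card e" if "e \<in> E" for e
  proof -
    obtain A B where "e = {A, B}" "A \<noteq> B" "RD_set (cycle_graph n) (A \<union> B)"
      using \<open>e \<in> E\<close> unfolding E_def by blast
    then show ?thesis using m(2)[of "A \<union> B"] card_Un_le[of A B] by simp
  qed
  have "0 \<in> \<Union>P" using partition_onD1[OF part] n by auto
  then have "P \<noteq> {}" by blast
  then obtain k where "1 \<le> k" "card P \<le> k * (3 + 2 - k)" "k * (m - 2) + card P \<le> sum card P"
    using edge_cover_bounds[OF finP _ cover edges hit pos heavy m(1)] by metis
  moreover have "sum card P = n"
    using sum_card_partition_on[OF part] by simp
  ultimately show thesis using that[of k] by simp
qed

lemma card_RD_partition_le_order:
  assumes "RD_partition (cycle_graph n) P"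
  shows "card P \<le> n"
  using card_partition_on_le[of "{..<n}" P] assms by (simp add: RD_partition_def cycle_graph_def)

text \<open>
  RD-sets of the cycle of order 5 have at least three vertices, so four classes have sizes 2, 1, 1, 1
  and each singleton must form a coalition with the pair \<open>D\<close>. The two vertices left over by such a
  coalition are adjacent, for each of the three choices of the singleton; this makes the complement
  of \<open>D\<close> a triangle.
\<close>

lemma card_RD_partition_cycle5:
  assumes P: "RD_partition (cycle_graph 5) P"
  shows "card P \<le> 3"
proof (rule ccontr)
  assume "\<not> card P \<le> 3"
  have n: "(3::nat) \<le> 5" by simp
  have size: "3 \<le> card R" if R: "RD_set (cycle_graph 5) R" for R
  proof -
    obtain g where "g \<le> card R" "5 = card R + 2 * g" using card_RD_set_cycle[OF n R] .
    then show ?thesis by presburger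
  qed
  obtain k where "1 \<le> k" "card P \<le> k * (5 - k)" "k * (3 - 2) + card P \<le> 5"
    using RD_partition_cycle_bounds[OF _ P, of 3] size by auto
  then have card4: "card P = 4" using \<open>\<not> card P \<le> 3\<close> by simp
  have verts: "pverts (cycle_graph 5) = {..<5}" by (simp add: cycle_graph_def)
  have part: "partition_on {..<5} P" using P by (simp add: RD_partition_def verts)
  have finP: "finite P" using part finite_elements by blast
  have pos: "1 \<le> card A" if "A \<in> P" for A
    using card_pos_partition_on[OF _ part that] by simp
  have total: "sum card P = 5" using sum_card_partition_on[OF part] by simp
  have "\<exists>D\<in>P. card D \<noteq> 1"
  proof (rule ccontr)
    assume "\<not> ?thesis"
    then have "sum card P = card P" by simp
    then show False using total card4 by simp
  qed
  then obtain D where D: "D \<in> P" "card D \<noteq> 1" by blast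
  have "card D + sum card (P - {D}) = 5" using total sum.remove[OF finP D(1), of card] by simp
  moreover have "card A + 2 \<le> sum card (P - {D})" if "A \<in> P - {D}" for A
  proof -
    have "card (P - {D} - {A}) = 2" using card4 D that finP by simp
    then have "2 \<le> sum card (P - {D} - {A})"
      using sum_mono[of "P - {D} - {A}" "\<lambda>_. 1" card] pos by simp
    then show ?thesis using sum.remove[of "P - {D}" A card] finP that by simp
  qed
  ultimately have single: "card A = 1" if "A \<in> P" "A \<noteq> D" for A
    using pos[OF D(1)] pos[OF that(1)] D(2) that by fastforce
  have "card (P - {D}) = 3" using card4 D finP by simp
  moreover have "sum card (P - {D}) = card (P - {D})" using single by simp
  ultimately have "card D = 2" using \<open>card D + sum card (P - {D}) = 5\<close> by simp
  have "D \<subseteq> {..<5}" using D part by (auto simp: partition_on_def)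
  then have "card ({..<5} - D) = 3" using \<open>card D = 2\<close>
    by (simp add: card_Diff_subset finite_subset)
  then obtain x y z where xyz: "{..<5} - D = {x, y, z}" "x \<noteq> y" "x \<noteq> z" "y \<noteq> z"
    by (auto simp: card_3_iff)
  have RD: "RD_set (cycle_graph 5) (insert v D)" if "v < 5" "v \<notin> D" for v
  proof -
    obtain A where A: "A \<in> P" "v \<in> A" using part \<open>v < 5\<close> by (auto simp: partition_on_def)
    then have "A \<noteq> D" using \<open>v \<notin> D\<close> by blast
    then have "A = {v}" using single[OF A(1)] A(2) by (metis card_1_singletonE singletonD)
    have "\<not> RD_set (cycle_graph 5) A" using size[of A] single[OF A(1) \<open>A \<noteq> D\<close>] by auto
    then obtain B where B: "B \<in> P" "B \<noteq> A" "RD_set (cycle_graph 5) (A \<union> B)"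
      using P A unfolding RD_partition_def RD_coalition_def by blast
    have "B = D"
    proof (rule ccontr)
      assume "B \<noteq> D"
      then show False
        using size[OF B(3)] card_Un_le[of A B] single[OF A(1) \<open>A \<noteq> D\<close>] single[OF B(1)] by simp
    qed
    then show ?thesis using B(3) \<open>A = {v}\<close> by simp
  qed
  have adj: "(u, w) \<in> parcs (cycle_graph 5)" if "{..<5} - D = {u, v, w}" "u \<noteq> v" "u \<noteq> w" for u v w
  proof -
    have "v < 5" "v \<notin> D" using that(1) by blast+
    have "{..<5} - insert v D \<subseteq> {u, w}" "u \<in> {..<5} - insert v D" using that by auto
    then have "\<exists>u'\<in>{u, w}. (u, u') \<in> parcs (cycle_graph 5)"
      using RD[OF \<open>v < 5\<close> \<open>v \<notin> D\<close>] unfolding RD_set_def verts by blast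
    moreover have "(u, u) \<notin> parcs (cycle_graph 5)" by (auto simp: cycle_graph_def mod_Suc)
    ultimately show ?thesis by blast
  qed
  have "(x, y) \<in> parcs (cycle_graph 5)" "(y, z) \<in> parcs (cycle_graph 5)" "(x, z) \<in> parcs (cycle_graph 5)"
    using adj[of x z y] adj[of y x z] adj[of x y z] xyz by (auto simp: insert_commute)
  then show False by (auto simp: cycle_graph_def mod_Suc split: if_splits)
qed

lemma card_RD_partition_cycle_le_6:
  assumes "4 \<le> n" "RD_partition (cycle_graph n) P"
  shows "card P \<le> 6"
proof -
  have "2 \<le> card R" if R: "RD_set (cycle_graph n) R" for R
  proof -
    obtain g where "g \<le> card R" "n = card R + 2 * g" using card_RD_set_cycle[OF _ R] assms by auto
    then show ?thesis using assms(1) by presburger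
  qed
  then obtain k where "1 \<le> k" "card P \<le> k * (5 - k)"
    using RD_partition_cycle_bounds[OF assms, of 2] by auto
  moreover have "k * (5 - k) \<le> 6"
  proof (cases "k \<le> 4")
    case True
    then have "k \<in> {0, 1, 2, 3, 4}" by auto
    then show ?thesis by auto
  qed simp
  ultimately show ?thesis by simp
qed

text \<open>
  A single star has at most four vertices; with two or more stars the weight bound applies. The
  arithmetic hypothesis is the one that \<open>card_RD_set_cycle\<close> turns into a lower bound for RD-sets.
\<close>

lemma card_RD_partition_cycle_le_of_large_RD_sets:
  assumes n: "4 \<le> n" and P: "RD_partition (cycle_graph n) P" and m: "2 \<le> m"
    and arith: "\<And>g r. g \<le> r \<Longrightarrow> n = r + 2 * g \<Longrightarrow> m \<le> r"
  shows "card P \<le> max 4 (n - 2 * (m - 2))"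
proof -
  have "m \<le> card R" if R: "RD_set (cycle_graph n) R" for R
  proof -
    obtain g where "g \<le> card R" "n = card R + 2 * g" using card_RD_set_cycle[OF _ R] n by auto
    then show ?thesis using arith by blast
  qed
  then obtain k where k: "1 \<le> k" "card P \<le> k * (5 - k)" "k * (m - 2) + card P \<le> n"
    using RD_partition_cycle_bounds[OF n P m] by metis
  show ?thesis
  proof (cases "k = 1")
    case True
    then show ?thesis using k(2) by simp
  next
    case False
    then have "2 * (m - 2) \<le> k * (m - 2)" using k(1) by (intro mult_right_mono) auto
    then show ?thesis using k(3) by linarith
  qed
qed

section \<open>Partitions read off from cyclic words\<close>

fun windows :: "'c list \<Rightarrow> ('c \<times> 'c \<times> 'c) set" where
  "windows (a # b # c # xs) = insert (a, b, c) (windows (b # c # xs))"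
| "windows _ = {}"

definition cyclic_windows :: "'c list \<Rightarrow> ('c \<times> 'c \<times> 'c) set" where
  "cyclic_windows xs = windows (xs @ take 2 xs)"

text \<open>
  The condition of \<open>RD_set_cycle_iff\<close> for the set of all positions whose letter lies in \<open>S\<close>.
\<close>

definition RD_windows :: "('c \<times> 'c \<times> 'c) set \<Rightarrow> 'c set \<Rightarrow> bool" where
  "RD_windows W S \<longleftrightarrow> (\<forall>(a, b, c)\<in>W. b \<in> S \<or> (a \<in> S) \<noteq> (c \<in> S))"

lemma windows_conv_nth:
  "windows xs = {(xs ! i, xs ! (i + 1), xs ! (i + 2)) | i. i + 2 < length xs}"
proof (induction xs rule: windows.induct)
  case (1 a b c xs)
  let ?f = "\<lambda>ys i. (ys ! i, ys ! (i + 1), ys ! (i + 2))"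
  let ?ys = "b # c # xs"
  have "{?f (a # ?ys) i | i. i + 2 < length (a # ?ys)} = ?f (a # ?ys) ` {i. i + 2 < length (a # ?ys)}"
    by blast
  also have "{i. i + 2 < length (a # ?ys)} = insert 0 (Suc ` {i. i + 2 < length ?ys})"
    by (auto simp: image_iff) presburger
  also have "?f (a # ?ys) ` \<dots> = insert (a, b, c) {?f ?ys i | i. i + 2 < length ?ys}"
    by (auto simp: image_iff)
  finally show ?case using 1 by simp
qed auto

lemma cyclic_windows_conv_nth:
  assumes "2 \<le> length xs"
  shows "cyclic_windows xs = {(xs ! i, xs ! ((i + 1) mod length xs), xs ! ((i + 2) mod length xs)) | i.
    i < length xs}"
proof -
  have nth: "(xs @ take 2 xs) ! j = xs ! (j mod length xs)" if "j < length xs + 2" for j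
  proof (cases "j < length xs")
    case False
    then show ?thesis using that assms by (simp add: nth_append le_mod_geq)
  qed (simp add: nth_append)
  have len: "i + 2 < length (xs @ take 2 xs) \<longleftrightarrow> i < length xs" for i
    using assms by simp
  have "((xs @ take 2 xs) ! i, (xs @ take 2 xs) ! (i + 1), (xs @ take 2 xs) ! (i + 2)) =
      (xs ! i, xs ! ((i + 1) mod length xs), xs ! ((i + 2) mod length xs))" if "i < length xs" for i
    using nth[of i] nth[of "i + 1"] nth[of "i + 2"] that by simp
  then show ?thesis
    unfolding cyclic_windows_def windows_conv_nth len
    by (intro Collect_cong ex_cong1) metis
qed

text \<open>
  A block that is followed by another copy of itself contributes just its three cyclic windows,
  no matter how often it is repeated.
\<close>

lemma windows_repeat_block:
  "windows ([a, b, c] @ concat (replicate t [a, b, c]) @ w) =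
    (if t = 0 then {} else {(a, b, c), (b, c, a), (c, a, b)}) \<union> windows (a # b # c # w)"
  by (induction t) auto

lemma RD_windows_simps [simp]:
  "RD_windows {} S"
  "RD_windows (insert (a, b, c) W) S \<longleftrightarrow> (b \<in> S \<or> (a \<in> S) \<noteq> (c \<in> S)) \<and> RD_windows W S"
  "RD_windows (W \<union> W') S \<longleftrightarrow> RD_windows W S \<and> RD_windows W' S"
  by (auto simp: RD_windows_def ball_Un)

text \<open>
  The letters of such a word are the classes of an RD-partition in which no class is an RD-set.
\<close>

definition coalition_word :: "'c list \<Rightarrow> bool" where
  "coalition_word xs \<longleftrightarrow> 3 \<le> length xs \<and> (\<forall>c\<in>set xs. \<not> RD_windows (cyclic_windows xs) {c} \<and>
     (\<exists>d\<in>set xs. d \<noteq> c \<and> RD_windows (cyclic_windows xs) {c, d}))"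

text \<open>
  In the first word the unions \<open>{0, 1}\<close>, \<open>{2, 3}\<close>, \<open>{4, 5}\<close> are the residue classes modulo \<open>3\<close>, each split
  between the repeated block and the last block. Such a perfect matching of the classes needs three
  disjoint RD-sets with at least \<open>n / 3\<close> vertices each, hence \<open>3 dvd n\<close>. The other two words realise the
  remaining pattern of \<open>k = 2\<close> stars with two leaves each: the coalitions are
  \<open>{0, 1}\<close>, \<open>{0, 2}\<close> and \<open>{3, 4}\<close>, \<open>{3, 5}\<close>.
\<close>

lemma coalition_words_repeated:
  "coalition_word ([0, 2, 4] @ concat (replicate t [0, 2, 4]) @ [1, 3, 5 :: nat])"
  "coalition_word ([4, 0, 5] @ concat (replicate t [4, 0, 5]) @ [3, 0, 1, 3, 2, 0, 3 :: nat])"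
  "coalition_word ([4, 0, 5] @ concat (replicate t [4, 0, 5]) @
     [3, 0, 0, 3, 3, 0, 1, 3, 2, 0, 3 :: nat])"
  (* without a second copy of the block, the windows that run from one copy to the next are absent *)
  by (cases "t = 0"; simp add: coalition_word_def cyclic_windows_def
      windows_repeat_block[simplified])+

text \<open>
  The coalitions are \<open>{0, 1}\<close>, \<open>{2, 3}\<close> for the first and fourth word, \<open>{0, 1}\<close>, \<open>{0, 2}\<close>
  for the second, and \<open>{0, 1}\<close>, \<open>{0, 2}\<close>, \<open>{3, 4}\<close> for the third and fifth.
\<close>

lemma coalition_words_small:
  "coalition_word [0, 1, 2, 3 :: nat]"
  "coalition_word [0, 1, 1, 2, 2 :: nat]"
  "coalition_word [0, 1, 3, 2, 0, 3, 4 :: nat]"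
  "coalition_word [0, 0, 2, 2, 0, 1, 2, 3 :: nat]"
  "coalition_word [0, 0, 3, 3, 0, 1, 3, 2, 0, 3, 4 :: nat]"
  by (simp_all add: coalition_word_def cyclic_windows_def)

lemma RD_set_cycle_word_iff:
  assumes "3 \<le> length xs"
  shows "RD_set (cycle_graph (length xs)) {i. i < length xs \<and> xs ! i \<in> S} \<longleftrightarrow>
    RD_windows (cyclic_windows xs) S"
proof -
  have bounds: "j mod length xs < length xs" for j using assms by (intro mod_less_divisor) linarith
  have len: "2 \<le> length xs" using assms by simp
  have "RD_windows (cyclic_windows xs) S \<longleftrightarrow> (\<forall>i<length xs. xs ! ((i + 1) mod length xs) \<in> S \<or>
      (xs ! i \<in> S) \<noteq> (xs ! ((i + 2) mod length xs) \<in> S))"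
    unfolding RD_windows_def cyclic_windows_conv_nth[OF len] by blast
  then show ?thesis
    unfolding RD_set_cycle_iff[OF assms] using bounds by auto
qed

lemma RD_partition_of_word:
  assumes "coalition_word xs"
  shows "\<exists>P. RD_partition (cycle_graph (length xs)) P \<and> card P = card (set xs)"
proof -
  define cls where "cls S = {i. i < length xs \<and> xs ! i \<in> S}" for S
  let ?G = "cycle_graph (length xs)"
  let ?P = "(\<lambda>c. cls {c}) ` set xs"
  have n: "3 \<le> length xs" using assms by (simp add: coalition_word_def)
  have RD: "RD_set ?G (cls S) \<longleftrightarrow> RD_windows (cyclic_windows xs) S" for S
    unfolding cls_def by (rule RD_set_cycle_word_iff[OF n])
  have verts: "pverts ?G = {..<length xs}" by (simp add: cycle_graph_def)
  have cls_sub: "cls S \<subseteq> pverts ?G" for S by (auto simp: cls_def verts)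
  have cls_ne: "cls {c} \<noteq> {}" if "c \<in> set xs" for c
    using that by (auto simp: cls_def in_set_conv_nth)
  have cls_disj: "cls {c} \<inter> cls {d} = {}" if "c \<noteq> d" for c d using that by (auto simp: cls_def)
  have inj: "inj_on (\<lambda>c. cls {c}) (set xs)"
  proof (rule inj_onI, rule ccontr)
    fix c d assume "c \<in> set xs" "cls {c} = cls {d}" "c \<noteq> d"
    then show False using cls_ne[of c] cls_disj[of c d] by simp
  qed
  have cls_Un: "cls {c} \<union> cls {d} = cls {c, d}" for c d by (auto simp: cls_def)
  have "partition_on (pverts ?G) ?P"
  proof (rule partition_onI)
    show "\<Union>?P = pverts ?G" by (auto simp: cls_def verts)
    show "disjnt p q" if "p \<in> ?P" "q \<in> ?P" "p \<noteq> q" for p q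
    proof -
      obtain c d where "p = cls {c}" "q = cls {d}" using \<open>p \<in> ?P\<close> \<open>q \<in> ?P\<close> by blast
      then show ?thesis using cls_disj[of c d] \<open>p \<noteq> q\<close> by (auto simp: disjnt_def)
    qed
    show "{} \<notin> ?P"
    proof
      assume "{} \<in> ?P"
      then obtain c where "{} = cls {c}" "c \<in> set xs" by (rule imageE)
      then show False using cls_ne[of c] by simp
    qed
  qed
  moreover have "\<exists>B\<in>?P - {cls {c}}. RD_coalition ?G (cls {c}) B" if "c \<in> set xs" for c
  proof -
    obtain d where d: "d \<in> set xs" "d \<noteq> c" "RD_windows (cyclic_windows xs) {c, d}"
      using assms \<open>c \<in> set xs\<close> unfolding coalition_word_def by blast
    have "RD_coalition ?G (cls {c}) (cls {d})"
      using assms d \<open>c \<in> set xs\<close> cls_sub cls_disj[of c d]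
      unfolding RD_coalition_def cls_Un RD coalition_word_def by auto
    moreover have "cls {d} \<noteq> cls {c}" using cls_ne[OF d(1)] cls_disj[OF d(2)] by auto
    ultimately show ?thesis using d by blast
  qed
  moreover have "\<not> RD_set ?G (cls {c})" if "c \<in> set xs" for c
    using assms that RD by (simp add: coalition_word_def)
  ultimately have "RD_partition ?G ?P" unfolding RD_partition_def ball_simps by blast
  then show ?thesis using card_image[OF inj] by blast
qed

text \<open>
  The triangle is the one cycle in which single vertices are RD-sets, so the words above, whose classes
  are not RD-sets, do not serve here.
\<close>

lemma RD_partition_cycle3: "\<exists>P. RD_partition (cycle_graph 3) P \<and> card P = 3"
proof -
  let ?P = "(\<lambda>v. {v}) ` {..<3::nat}"
  have n: "(3::nat) \<le> 3" by simp
  have "RD_set (cycle_graph 3) {v}" if "v < 3" for v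
    unfolding RD_set_cycle_iff[OF n] using that by (auto simp: mod_Suc split: if_splits)
  moreover have "partition_on {..<3::nat} ?P"
    by (rule partition_onI) (auto simp: disjnt_def)
  moreover have "pverts (cycle_graph 3) = {..<3}" by (simp add: cycle_graph_def)
  ultimately have "RD_partition (cycle_graph 3) ?P"
    unfolding RD_partition_def by auto
  moreover have "card ?P = 3" by (simp add: card_image)
  ultimately show ?thesis by blast
qed

lemma ex_RD_partition_6:
  assumes "n = 6 \<or> n = 9 \<or> n = 10 \<or> 12 \<le> n"
  shows "\<exists>P. RD_partition (cycle_graph n) P \<and> card P = 6"
proof -
  let ?w0 = "\<lambda>t. [0, 2, 4] @ concat (replicate t [0, 2, 4]) @ [1, 3, 5 :: nat]"
  let ?w1 = "\<lambda>t. [4, 0, 5] @ concat (replicate t [4, 0, 5]) @ [3, 0, 1, 3, 2, 0, 3 :: nat]"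
  let ?w2 = "\<lambda>t. [4, 0, 5] @ concat (replicate t [4, 0, 5]) @
     [3, 0, 0, 3, 3, 0, 1, 3, 2, 0, 3 :: nat]"
  have len: "length (concat (replicate t [a, b, c])) = 3 * t" for t and a b c :: nat
    by (induction t) auto
  have sub: "set (concat (replicate t [a, b, c])) \<subseteq> {a, b, c}" for t and a b c :: nat
    by (induction t) auto
  have "set (?w0 t) = {0, 2, 4, 1, 3, 5}" for t using sub[of t 0 2 4] by auto
  then have card0: "card (set (?w0 t)) = 6" for t by simp
  have "set (?w1 t) = {4, 0, 5, 3, 1, 2}" for t using sub[of t 4 0 5] by auto
  then have card1: "card (set (?w1 t)) = 6" for t by simp
  have "set (?w2 t) = {4, 0, 5, 3, 1, 2}" for t using sub[of t 4 0 5] by auto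
  then have card2: "card (set (?w2 t)) = 6" for t by simp
  have "(\<exists>t. n = 6 + 3 * t) \<or> (\<exists>t. n = 10 + 3 * t) \<or> (\<exists>t. n = 14 + 3 * t)"
    using assms by presburger
  then consider t where "n = length (?w0 t)" | t where "n = length (?w1 t)" | t where "n = length (?w2 t)"
    unfolding length_append len by fastforce
  then show ?thesis
  proof cases
    case 1
    show ?thesis
      using RD_partition_of_word[OF coalition_words_repeated(1)[of t]] unfolding 1 card0 .
  next
    case 2
    show ?thesis
      using RD_partition_of_word[OF coalition_words_repeated(2)[of t]] unfolding 2 card1 .
  next
    case 3
    show ?thesis
      using RD_partition_of_word[OF coalition_words_repeated(3)[of t]] unfolding 3 card2 .
  qed
qed

lemma ex_RD_partition_small:
  "\<exists>P. RD_partition (cycle_graph 4) P \<and> card P = 4"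
  "\<exists>P. RD_partition (cycle_graph 5) P \<and> card P = 3"
  "\<exists>P. RD_partition (cycle_graph 7) P \<and> card P = 5"
  "\<exists>P. RD_partition (cycle_graph 8) P \<and> card P = 4"
  "\<exists>P. RD_partition (cycle_graph 11) P \<and> card P = 5"
  using coalition_words_small[THEN RD_partition_of_word] by (simp_all add: numeral_eq_Suc card_insert_if)

section \<open>The restrained dominating coalition number of cycles\<close>

lemma RC_eqI:
  assumes "RD_partition G P" "card P = k" and "\<And>Q. RD_partition G Q \<Longrightarrow> card Q \<le> k"
  shows "RC G = k"
  unfolding RC_def
proof (rule Max_eqI)
  show "finite {card Q | Q. RD_partition G Q}"
    by (rule finite_subset[of _ "{..k}"]) (use assms(3) in auto)
qed (use assms in auto)

theorem proposition7:
  fixes n :: nat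
  assumes "n \<ge> 3"
  shows "RC (cycle_graph n) =
    (if n = 3 \<or> n = 5 then 3
     else if n = 4 \<or> n = 8 then 4
     else if n = 7 \<or> n = 11 then 5
     else 6)"
proof -
  have eq: "RC (cycle_graph n) = k"
    if "\<exists>P. RD_partition (cycle_graph n) P \<and> card P = k"
      "\<And>P. RD_partition (cycle_graph n) P \<Longrightarrow> card P \<le> k" for k
    using that RC_eqI by metis
  consider "n = 3" | "n = 4" | "n = 5" | "n = 7" | "n = 8" | "n = 11"
    | "n = 6 \<or> n = 9 \<or> n = 10 \<or> 12 \<le> n"
    using assms by linarith
  then show ?thesis
  proof cases
    case 1
    then show ?thesis using eq[of 3] RD_partition_cycle3 card_RD_partition_le_order by simp
  next
    case 2
    then show ?thesis
      using eq[of 4] ex_RD_partition_small(1) card_RD_partition_le_order by simp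
  next
    case 3
    then show ?thesis
      using eq[of 3] ex_RD_partition_small(2) card_RD_partition_cycle5 by simp
  next
    case 4
    have "card P \<le> 5" if "RD_partition (cycle_graph n) P" for P
    proof -
      have "3 \<le> r" if "g \<le> r" "n = r + 2 * g" for g r using that 4 by presburger
      then show ?thesis
        using card_RD_partition_cycle_le_of_large_RD_sets[OF _ that, of 3] 4 by simp
    qed
    then show ?thesis using 4 eq[of 5] ex_RD_partition_small(3) by simp
  next
    case 5
    have "card P \<le> 4" if "RD_partition (cycle_graph n) P" for P
    proof -
      have "4 \<le> r" if "g \<le> r" "n = r + 2 * g" for g r using that 5 by presburger
      then show ?thesis
        using card_RD_partition_cycle_le_of_large_RD_sets[OF _ that, of 4] 5 by simp
    qed
    then show ?thesis using 5 eq[of 4] ex_RD_partition_small(4) by simp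
  next
    case 6
    have "card P \<le> 5" if "RD_partition (cycle_graph n) P" for P
    proof -
      have "5 \<le> r" if "g \<le> r" "n = r + 2 * g" for g r using that 6 by presburger
      then show ?thesis
        using card_RD_partition_cycle_le_of_large_RD_sets[OF _ that, of 5] 6 by simp
    qed
    then show ?thesis using 6 eq[of 5] ex_RD_partition_small(5) by simp
  next
    case 7
    then have "4 \<le> n" by linarith
    then show ?thesis
      using 7 eq[of 6] ex_RD_partition_6[OF 7] card_RD_partition_cycle_le_6 by auto
  qed
qed

end
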